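(* Let $K\subset S^3$ be a knot, let $d=\deg_z P_K$ be the maximal $z$-degree of its HOMFLY--PT polynomial, and write $\nabla_K(z)=\sum_j c_j z^j$ for its Conway polynomial. If $c_d\notin\{1,-1\}$, then $$\mathrm{td}(K)\ge d+1.$$ Equivalently: either $\mathrm{sp}\Delta_t(K)<d$, in which case $c_d=0$ and $\mathrm{td}(K)\ge d+1$; or $\mathrm{sp}\Delta_t(K)=d$, in which case $|c_d|$ is the absolute value of the extreme (leading) coefficient of the Alexander polynomial $\Delta_K(t)$, and $\mathrm{td}(K)\ge d+1$ holds as soon as that extreme coefficient is not $\pm1$.
   Context: The HOMFLY--PT polynomial $P_L(a,z)\in\mathbb Z[a^{\pm1},z^{\pm1}]$ of oriented links is normalised by $P_U(a,z)=1$ for the unknot $U$ and $$a\,P_{L_+}(a,z)-a^{-1}P_{L_-}(a,z)=z\,P_{L_0}(a,z),$$ where $L_+,L_-,L_0$ differ only near one crossing, which is positive, negative, and smoothed according to orientation, respectively. Thus $P_K(1,z)=\nabla_K(z)$ is the Conway polynomial, and up to a unit $\pm t^r$ one has $\Delta_K(t)=\nabla_K(t^{1/2}-t^{-1/2})$. The span $\mathrm{sp}\Delta_t(K)$ is the maximal exponent minus the minimal exponent of $\Delta_K(t)$. An ordinary oriented binary skein tree for $K$ has a diagram of $K$ at its root and unlink diagrams at its leaves. At each internal vertex a crossing of the current oriented diagram is chosen; one child is obtained by switching that crossing and the other by its oriented smoothing. Reidemeister moves and diagram isotopies may be made without cost between resolutions. The depth of the tree is the maximum number of edges in a root-to-leaf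 path, counting both switching and smoothing edges. The skein tree depth $\mathrm{td}(K)$ is the minimum of this depth over all such trees and all diagrams of $K$. *)

theory Defs
  imports
    "HOL-Library.Poly_Mapping"
    "HOL-Library.Product_Plus"
    "HOL-Library.Extended_Nat"
    "HOL-Library.Extended_Real"
    "HOL-Analysis.Analysis"
begin

section \<open>Oriented link diagrams\<close>

text \<open>
  A planar link diagram in general position with respect to the height function is cut by
  horizontal lines into layers containing one local minimum, one local maximum or one crossing.
  It is recorded as the list of these events, read from bottom to top.  A horizontal slice is the
  list of vertical directions of the strands meeting it, from left to right, counted from 0.

  \<^item> \<open>Cup i v\<close> is a minimum creating strands \<open>i\<close> and \<open>i + 1\<close>, the left one with direction \<open>v\<close>.
  \<^item> \<open>Cap i\<close> is a maximum joining strands \<open>i\<close> and \<open>i + 1\<close>.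
  \<^item> \<open>Cross i b\<close> interchanges strands \<open>i\<close> and \<open>i + 1\<close>; the strand from bottom left to top right is
    the over-strand iff \<open>b\<close>.
\<close>

datatype dir = Up | Down

fun opp :: "dir \<Rightarrow> dir" where
  "opp Up = Down"
| "opp Down = Up"

datatype event = Cup nat dir | Cap nat | Cross nat bool

type_synonym diagram = "event list"

fun event_step :: "event \<Rightarrow> dir list \<Rightarrow> dir list option" where
  "event_step (Cup i v) s =
     (if i \<le> length s then Some (take i s @ [v, opp v] @ drop i s) else None)"
| "event_step (Cap i) s =
     (if Suc i < length s \<and> s ! i \<noteq> s ! Suc i then Some (take i s @ drop (i + 2) s) else None)"
| "event_step (Cross i b) s =
     (if Suc i < length s then Some (take i s @ [s ! Suc i, s ! i] @ drop (i + 2) s) else None)"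

primrec run :: "event list \<Rightarrow> dir list \<Rightarrow> dir list option" where
  "run [] s = Some s"
| "run (e # es) s = Option.bind (event_step e s) (run es)"

definition link_diagram :: "diagram \<Rightarrow> bool" where
  "link_diagram D \<longleftrightarrow> run D [] = Some []"

definition slice :: "diagram \<Rightarrow> nat \<Rightarrow> dir list" where
  "slice D k = the (run (take k D) [])"

text \<open>Points \<open>(k, j)\<close> stand for strand \<open>j\<close> of the slice below event \<open>k\<close> (equivalently, above
  event \<open>k - 1\<close>).\<close>

inductive joined :: "diagram \<Rightarrow> nat \<times> nat \<Rightarrow> nat \<times> nat \<Rightarrow> bool" for D where
  cup: "k < length D \<Longrightarrow> D ! k = Cup i v \<Longrightarrow> joined D (Suc k, i) (Suc k, Suc i)"
| cup_left: "k < length D \<Longrightarrow> D ! k = Cup i v \<Longrightarrow> j < i \<Longrightarrow> joined D (k, j) (Suc k, j)"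
| cup_right: "k < length D \<Longrightarrow> D ! k = Cup i v \<Longrightarrow> i \<le> j \<Longrightarrow> joined D (k, j) (Suc k, j + 2)"
| cap: "k < length D \<Longrightarrow> D ! k = Cap i \<Longrightarrow> joined D (k, i) (k, Suc i)"
| cap_left: "k < length D \<Longrightarrow> D ! k = Cap i \<Longrightarrow> j < i \<Longrightarrow> joined D (k, j) (Suc k, j)"
| cap_right: "k < length D \<Longrightarrow> D ! k = Cap i \<Longrightarrow> i \<le> j \<Longrightarrow> joined D (k, j + 2) (Suc k, j)"
| cross_rising: "k < length D \<Longrightarrow> D ! k = Cross i b \<Longrightarrow> joined D (k, i) (Suc k, Suc i)"
| cross_falling: "k < length D \<Longrightarrow> D ! k = Cross i b \<Longrightarrow> joined D (k, Suc i) (Suc k, i)"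
| cross_other: "k < length D \<Longrightarrow> D ! k = Cross i b \<Longrightarrow> j \<noteq> i \<Longrightarrow> j \<noteq> Suc i \<Longrightarrow>
    joined D (k, j) (Suc k, j)"

definition diagram_points :: "diagram \<Rightarrow> (nat \<times> nat) set" where
  "diagram_points D = {(k, j). k \<le> length D \<and> j < length (slice D k)}"

definition link_components :: "diagram \<Rightarrow> (nat \<times> nat) set set" where
  "link_components D = diagram_points D //
     {(p, q). p \<in> diagram_points D \<and> q \<in> diagram_points D \<and> equivclp (joined D) p q}"

definition knot_diagram :: "diagram \<Rightarrow> bool" where
  "knot_diagram D \<longleftrightarrow> link_diagram D \<and> card (link_components D) = 1"


section \<open>Planar isotopy and Reidemeister moves\<close>

fun pos :: "event \<Rightarrow> nat" where
  "pos (Cup i v) = i"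
| "pos (Cap i) = i"
| "pos (Cross i b) = i"

fun place :: "nat \<Rightarrow> event \<Rightarrow> event" where
  "place j (Cup i v) = Cup j v"
| "place j (Cap i) = Cap j"
| "place j (Cross i b) = Cross j b"

fun strands_in :: "event \<Rightarrow> nat" where
  "strands_in (Cup i v) = 0"
| "strands_in (Cap i) = 2"
| "strands_in (Cross i b) = 2"

fun strands_out :: "event \<Rightarrow> nat" where
  "strands_out (Cup i v) = 2"
| "strands_out (Cap i) = 0"
| "strands_out (Cross i b) = 2"

text \<open>
  The moves of Freyd--Yetter and Turaev: two Morse diagrams represent isotopic links iff they are
  related by these moves.  The first four groups (exchange of the heights of two distant events,
  straightening of a strand, sliding a strand across a minimum or a maximum) generate, together
  with the last three, planar isotopy and the usual moves in every position.
  In \<open>reidemeister_3\<close> the side condition excludes the two patterns in which the three strands are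
  cyclically above one another.
\<close>

inductive local_move :: "event list \<Rightarrow> event list \<Rightarrow> bool" where
  exchange: "pos e \<le> j \<Longrightarrow>
    local_move [e, place (j + strands_out e) f] [place (j + strands_in e) f, e]"
| straighten_left: "local_move [Cup (Suc i) v, Cap i] []"
| straighten_right: "local_move [Cup i v, Cap (Suc i)] []"
| slide_cup: "local_move [Cup i v, Cross (Suc i) b] [Cup (Suc i) v, Cross i (\<not> b)]"
| slide_cap: "local_move [Cross (Suc i) b, Cap i] [Cross i (\<not> b), Cap (Suc i)]"
| reidemeister_1_right: "local_move [Cup (Suc i) v, Cross i b, Cap (Suc i)] []"
| reidemeister_1_left: "local_move [Cup i v, Cross (Suc i) b, Cap i] []"
| reidemeister_2: "local_move [Cross i b, Cross i (\<not> b)] []"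
| reidemeister_3: "b\<^sub>2 = b\<^sub>1 \<or> b\<^sub>2 = b\<^sub>3 \<Longrightarrow>
    local_move [Cross i b\<^sub>1, Cross (Suc i) b\<^sub>2, Cross i b\<^sub>3]
               [Cross (Suc i) b\<^sub>3, Cross i b\<^sub>2, Cross (Suc i) b\<^sub>1]"

definition diagram_move :: "diagram \<Rightarrow> diagram \<Rightarrow> bool" where
  "diagram_move D E \<longleftrightarrow> link_diagram D \<and> link_diagram E \<and>
     (\<exists>u l r v. D = u @ l @ v \<and> E = u @ r @ v \<and> local_move l r)"

definition isotopic :: "diagram \<Rightarrow> diagram \<Rightarrow> bool" where
  "isotopic D E \<longleftrightarrow> link_diagram D \<and> link_diagram E \<and> equivclp diagram_move D E"

definition unknot :: diagram where
  "unknot = [Cup 0 Up, Cap 0]"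

text \<open>The unlink of \<open>c\<close> components is the split union of \<open>c\<close> round circles.\<close>

definition unlink_diagram :: "diagram \<Rightarrow> bool" where
  "unlink_diagram D \<longleftrightarrow> (\<exists>c>0. isotopic (concat (replicate c unknot)) D)"


section \<open>Switching and smoothing a crossing\<close>

definition crossing :: "diagram \<Rightarrow> nat \<Rightarrow> bool" where
  "crossing D k \<longleftrightarrow> k < length D \<and> (\<exists>i b. D ! k = Cross i b)"

text \<open>If both strands point up, or both point down, the crossing is positive iff the strand from
  bottom left to top right is the over-strand; reversing one strand changes the sign.\<close>

definition positive_crossing :: "diagram \<Rightarrow> nat \<Rightarrow> bool" where
  "positive_crossing D k \<longleftrightarrow> k < length D \<and>
     (\<exists>i b. D ! k = Cross i b \<and> b = (slice D k ! i = slice D k ! Suc i))"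

definition switch_crossing :: "diagram \<Rightarrow> nat \<Rightarrow> diagram" where
  "switch_crossing D k = (case D ! k of Cross i b \<Rightarrow> D[k := Cross i (\<not> b)] | _ \<Rightarrow> D)"

text \<open>The smoothing respecting the orientation consists of two vertical strands if both strands
  have the same vertical direction, and of a maximum below a minimum otherwise.\<close>

definition smooth_crossing :: "diagram \<Rightarrow> nat \<Rightarrow> diagram" where
  "smooth_crossing D k = (case D ! k of
     Cross i b \<Rightarrow>
       take k D @
       (if slice D k ! i = slice D k ! Suc i then [] else [Cap i, Cup i (slice D k ! Suc i)]) @
       drop (Suc k) D
   | _ \<Rightarrow> D)"


section \<open>Skein trees\<close>

text \<open>\<open>Resolve D k S T\<close> resolves crossing \<open>k\<close> of \<open>D\<close>; the roots of \<open>S\<close> and \<open>T\<close> are obtained by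
  switching and by smoothing it, each followed by arbitrary isotopies.\<close>

datatype skein_tree =
    Leaf diagram
  | Resolve diagram nat skein_tree skein_tree

fun tree_root :: "skein_tree \<Rightarrow> diagram" where
  "tree_root (Leaf D) = D"
| "tree_root (Resolve D k S T) = D"

fun tree_depth :: "skein_tree \<Rightarrow> nat" where
  "tree_depth (Leaf D) = 0"
| "tree_depth (Resolve D k S T) = Suc (max (tree_depth S) (tree_depth T))"

fun valid_skein_tree :: "skein_tree \<Rightarrow> bool" where
  "valid_skein_tree (Leaf D) \<longleftrightarrow> unlink_diagram D"
| "valid_skein_tree (Resolve D k S T) \<longleftrightarrow> link_diagram D \<and> crossing D k \<and>
     isotopic (switch_crossing D k) (tree_root S) \<and>
     isotopic (smooth_crossing D k) (tree_root T) \<and>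
     valid_skein_tree S \<and> valid_skein_tree T"

definition skein_tree_depth :: "diagram \<Rightarrow> enat" where
  "skein_tree_depth K =
     (INF T \<in> {T. valid_skein_tree T \<and> isotopic K (tree_root T)}. enat (tree_depth T))"


section \<open>The HOMFLY--PT, Conway and Alexander polynomials\<close>

text \<open>Laurent polynomials are elements of group rings: the key \<open>(i, j)\<close> stands for the monomial
  with exponent \<open>i\<close> of \<open>a\<close> and exponent \<open>j\<close> of \<open>z\<close>.\<close>

type_synonym laurent = "int \<Rightarrow>\<^sub>0 int"
type_synonym laurent2 = "(int \<times> int) \<Rightarrow>\<^sub>0 int"

definition mono_az :: "int \<Rightarrow> int \<Rightarrow> laurent2" where
  "mono_az i j = Poly_Mapping.single (i, j) 1"

text \<open>The polynomial invariant of oriented links characterised by its normalisation and its skein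
  relation.  Its existence and uniqueness on nonempty links are classical; on the empty diagram,
  which occurs in no skein triple, the value is arbitrary.\<close>

definition homfly_pt :: "(diagram \<Rightarrow> laurent2) \<Rightarrow> bool" where
  "homfly_pt P \<longleftrightarrow>
     (\<forall>D E. isotopic D E \<longrightarrow> P D = P E) \<and>
     P unknot = 1 \<and>
     (\<forall>D k. link_diagram D \<and> positive_crossing D k \<longrightarrow>
        mono_az 1 0 * P D - mono_az (-1) 0 * P (switch_crossing D k) =
        mono_az 0 1 * P (smooth_crossing D k))"

definition z_degree :: "laurent2 \<Rightarrow> int" where
  "z_degree p = Max (snd ` Poly_Mapping.keys p)"

text \<open>The specialisation \<open>a = 1\<close>, which takes the HOMFLY--PT polynomial to the Conway polynomial.\<close>

definition conway :: "laurent2 \<Rightarrow> laurent" where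
  "conway p = (\<Sum>(i, j)\<in>Poly_Mapping.keys p.
     Poly_Mapping.single j (Poly_Mapping.lookup p (i, j)))"

definition laurent_eval :: "laurent \<Rightarrow> real \<Rightarrow> real" where
  "laurent_eval p x = (\<Sum>k\<in>Poly_Mapping.keys p. of_int (Poly_Mapping.lookup p k) * x powi k)"

text \<open>The Alexander polynomial is determined by the Conway polynomial \<open>N\<close> only up to a unit;
  this says that \<open>A\<close> is one of its representatives.  The identity of Laurent polynomials in
  the square root of \<open>t\<close> is stated as an identity of functions of \<open>t > 0\<close>.\<close>

definition alexander_of :: "laurent \<Rightarrow> laurent \<Rightarrow> bool" where
  "alexander_of N A \<longleftrightarrow> (\<exists>u\<in>{1, -1 :: real}. \<exists>r :: int. \<forall>t>0.
     laurent_eval A t = u * t powi r * laurent_eval N (sqrt t - 1 / sqrt t))"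

text \<open>The zero polynomial has span \<open>- \<infinity>\<close>, as a supremum minus an infimum over the empty set.\<close>

definition exponent_span :: "laurent \<Rightarrow> ereal" where
  "exponent_span p =
     (SUP k \<in> Poly_Mapping.keys p. ereal (of_int k)) - (INF k \<in> Poly_Mapping.keys p. ereal (of_int k))"

definition leading_coeff :: "laurent \<Rightarrow> int" where
  "leading_coeff p = Poly_Mapping.lookup p (Max (Poly_Mapping.keys p))"

end

theory Submission
  imports Defs
begin

text \<open>
  Suppose that a skein tree of depth \<open>n\<close> has a diagram of \<open>K\<close> at its root.  The skein relation
  expresses the polynomial of a vertex by those of its children, with a power of \<open>a\<close> as coefficient
  of the switched diagram and \<open>z\<close> times a signed power of \<open>a\<close> as coefficient of the smoothed one.
  The unlink of \<open>c\<close> components at a leaf has polynomial \<open>((a - 1/a) / z)^(c - 1)\<close>, with no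
  positive power of \<open>z\<close>, and without a \<open>z\<close>-free term unless it is the unknot.  Hence the root has
  \<open>z\<close>-degree at most \<open>n\<close>, and \<open>z^n\<close> can come only from the one branch that smooths \<open>n\<close> times and ends
  in an unknot: its coefficient is 0 or a signed power of \<open>a\<close> (\<open>skein_tree_top_z_unit\<close>).  So
  \<open>d \<le> n\<close>, and if \<open>d = n\<close> then setting \<open>a = 1\<close> in the coefficient of \<open>z^d\<close> shows \<open>c\<^sub>d = 1\<close> or
  \<open>c\<^sub>d = -1\<close>.

  The degree makes sense only if the polynomial is not zero.  Under \<open>z = a - 1/a\<close> the skein
  relation is satisfied by the constant 1, which is also the value at all unlinks; so the
  polynomial at the root of a skein tree takes the value 1 there (\<open>skein_tree_evaluation\<close>).

  The second part is about Laurent polynomials alone.  If the Conway polynomial is zero, so is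
  \<open>\<Delta>\<close>, whose span is then \<open>- \<infinity>\<close>.  If it has degree \<open>m\<close>, then \<open>m \<le> d\<close>, and
  comparing growth rates in \<open>\<Delta>(t) = \<plusminus> t^r \<nabla>(t^(1/2) - t^(-1/2))\<close> for \<open>t\<close> tending to infinity and to 0 shows that the span of \<open>\<Delta>\<close> is \<open>m\<close> and that the leading
  coefficients agree up to sign (\<open>alexander_of_asymptotics\<close>).
\<close>

section \<open>Unlinks and the skein relation\<close>

lemma run_append: "run (xs @ ys) s = Option.bind (run xs s) (run ys)"
proof (induction xs arbitrary: s)
  case (Cons e xs)
  show ?case by (cases "event_step e s") (simp_all add: Cons)
qed simp

lemma run_unlink: "run (concat (replicate n unknot)) [] = Some []"
  by (induction n) (auto simp: unknot_def)

lemma isotopic_sym: "isotopic D E \<Longrightarrow> isotopic E D"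
  unfolding isotopic_def by (auto intro: equivclp_sym)

lemma isotopic_trans [trans]: "isotopic D E \<Longrightarrow> isotopic E F \<Longrightarrow> isotopic D F"
  unfolding isotopic_def by (auto intro: equivclp_trans)

lemma isotopic_by_move:
  assumes "local_move l r" "D = u @ l @ v" "E = u @ r @ v" "link_diagram D" "link_diagram E"
  shows "isotopic D E"
  using assms unfolding isotopic_def diagram_move_def by blast

lemma link_after_unlink:
  "link_diagram (concat (replicate n unknot) @ D) \<longleftrightarrow> link_diagram D"
  by (simp add: link_diagram_def run_append run_unlink)

lemma isotopic_curl:
  "isotopic (concat (replicate n unknot) @ [Cup 0 Up, Cup 1 Up, Cross 0 b, Cap 1, Cap 0])
     (concat (replicate n unknot) @ unknot)"
  by (rule isotopic_by_move[OF reidemeister_1_right[of 0 Up b],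
        where u = "concat (replicate n unknot) @ [Cup 0 Up]" and v = "[Cap 0]"])
    (simp_all add: link_after_unlink, simp_all add: unknot_def link_diagram_def)

text \<open>The inner circle is pulled out to the left of the outer one.  A Reidemeister 2 move first
  inserts a clasp on the left strand of the outer circle and the left strand of the inner one.
  Sliding the outer strand across the minimum and across the maximum of the inner circle moves it
  to the other side of that circle, where another Reidemeister 2 move removes the two crossings.
  The two circles are then side by side and need only be separated in height.\<close>

lemma isotopic_nested_circles:
  "isotopic (concat (replicate n unknot) @ [Cup 0 Up, Cup 1 Up, Cap 1, Cap 0])
     (concat (replicate n unknot) @ unknot @ unknot)"
proof -
  define U where "U = concat (replicate n unknot)"
  have step: "isotopic (U @ p @ l @ q) (U @ p @ r @ q)"
    if "local_move l r" "link_diagram (p @ l @ q)" "link_diagram (p @ r @ q)" for p l q r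
    by (rule isotopic_by_move[OF that(1), where u = "U @ p" and v = q])
      (use that in \<open>simp_all add: U_def link_after_unlink\<close>)
  have "isotopic (U @ [Cup 0 Up, Cup 1 Up, Cap 1, Cap 0])
      (U @ [Cup 0 Up, Cup 1 Up, Cross 0 True, Cross 0 False, Cap 1, Cap 0])"
    using isotopic_sym[OF step[OF reidemeister_2[of 0 True],
        of "[Cup 0 Up, Cup 1 Up]" "[Cap 1, Cap 0]"]]
    by (simp add: link_diagram_def)
  also have "isotopic \<dots> (U @ [Cup 0 Up, Cup 0 Up, Cross 1 False, Cross 0 False, Cap 1, Cap 0])"
    using isotopic_sym[OF step[OF slide_cup[of 0 Up False],
        of "[Cup 0 Up]" "[Cross 0 False, Cap 1, Cap 0]"]]
    by (simp add: link_diagram_def)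
  also have "isotopic \<dots> (U @ [Cup 0 Up, Cup 0 Up, Cross 1 False, Cross 1 True, Cap 0, Cap 0])"
    using isotopic_sym[OF step[OF slide_cap[of 0 True],
        of "[Cup 0 Up, Cup 0 Up, Cross 1 False]" "[Cap 0]"]]
    by (simp add: link_diagram_def)
  also have "isotopic \<dots> (U @ [Cup 0 Up, Cup 0 Up, Cap 0, Cap 0])"
    using step[OF reidemeister_2[of 1 False], of "[Cup 0 Up, Cup 0 Up]" "[Cap 0, Cap 0]"]
    by (simp add: link_diagram_def)
  also have "isotopic \<dots> (U @ [Cup 0 Up, Cup 2 Up, Cap 0, Cap 0])"
    using isotopic_sym[OF step[OF exchange[of "Cup 0 Up" 0 "Cup 0 Up"],
        of "[]" "[Cap 0, Cap 0]"]]
    by (simp add: link_diagram_def numeral_2_eq_2)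
  also have "isotopic \<dots> (U @ unknot @ unknot)"
    using isotopic_sym[OF step[OF exchange[of "Cap 0" 0 "Cup 0 Up"],
        of "[Cup 0 Up]" "[Cap 0]"]]
    by (simp add: link_diagram_def unknot_def numeral_2_eq_2)
  finally show ?thesis unfolding U_def .
qed

lemma homfly_pt_invariant: "homfly_pt P \<Longrightarrow> isotopic D E \<Longrightarrow> P D = P E"
  unfolding homfly_pt_def by blast

lemma homfly_pt_skein:
  "homfly_pt P \<Longrightarrow> link_diagram D \<Longrightarrow> positive_crossing D k \<Longrightarrow>
     mono_az 1 0 * P D - mono_az (-1) 0 * P (switch_crossing D k) =
     mono_az 0 1 * P (smooth_crossing D k)"
  unfolding homfly_pt_def by blast

text \<open>The skein triple at the crossing of a curl: both signs of the crossing give back the unlink,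
  and the smoothing cuts off a circle nested in another one.\<close>

lemma homfly_pt_add_circle:
  assumes P: "homfly_pt P" and n: "n > 0"
  shows "mono_az 1 0 * P (concat (replicate n unknot))
      - mono_az (-1) 0 * P (concat (replicate n unknot))
    = mono_az 0 1 * P (concat (replicate (Suc n) unknot))"
proof -
  obtain m where m: "n = Suc m" using n by (cases n) auto
  define U where "U = concat (replicate m unknot)"
  define D where "D b = U @ [Cup 0 Up, Cup 1 Up, Cross 0 b, Cap 1, Cap 0]" for b
  have snoc: "concat (replicate (Suc i) unknot) = concat (replicate i unknot) @ unknot" for i
    by (induction i) auto
  have link: "link_diagram (D True)"
    unfolding D_def U_def by (simp add: link_after_unlink) (simp add: link_diagram_def)
  have slice: "slice (D True) (length U + 2) = [Up, Up, Down, Down]"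
    by (simp add: D_def slice_def run_append U_def run_unlink)
  have ev: "D True ! (length U + 2) = Cross 0 True"
    by (simp add: D_def nth_append)
  have pos: "positive_crossing (D True) (length U + 2)"
    unfolding positive_crossing_def slice ev by (simp add: D_def)
  have sw: "switch_crossing (D True) (length U + 2) = D False"
    unfolding switch_crossing_def ev by (simp add: D_def list_update_append)
  have sm: "smooth_crossing (D True) (length U + 2) = U @ [Cup 0 Up, Cup 1 Up, Cap 1, Cap 0]"
    unfolding smooth_crossing_def ev slice by (simp add: D_def)
  have "P (D b) = P (concat (replicate n unknot))" for b
    using homfly_pt_invariant[OF P isotopic_curl[of m b]] snoc[of m] by (simp add: D_def U_def m)
  moreover have "P (smooth_crossing (D True) (length U + 2)) = P (concat (replicate (Suc n) unknot))"
    using homfly_pt_invariant[OF P isotopic_nested_circles[of m]]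
    unfolding sm unfolding m snoc U_def by simp
  ultimately show ?thesis
    using homfly_pt_skein[OF P link pos] unfolding sw by simp
qed

text \<open>A skein tree may resolve crossings of either sign.  At a negative crossing of \<open>D\<close> the skein
  relation is read at the switched diagram, whose switching is \<open>D\<close> and whose smoothing is that
  of \<open>D\<close>; the sign \<open>e\<close> of the crossing then enters the exponents of \<open>a\<close> and the right-hand side.\<close>

lemma homfly_pt_resolve:
  assumes P: "homfly_pt P" and "link_diagram D" "crossing D k" "link_diagram (switch_crossing D k)"
  obtains e :: int where "e \<in> {1, -1}"
    "mono_az e 0 * P D - mono_az (- e) 0 * P (switch_crossing D k) =
     Poly_Mapping.single (0, 1) e * P (smooth_crossing D k)"
proof (cases "positive_crossing D k")
  case True
  then show ?thesis
    using homfly_pt_skein[OF P assms(2) True] that[of 1] by (simp add: mono_az_def)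
next
  case False
  obtain i b where k: "k < length D" and ib: "D ! k = Cross i b"
    using assms(3) by (auto simp: crossing_def)
  define E where "E = switch_crossing D k"
  have E: "E = D[k := Cross i (\<not> b)]" by (simp add: E_def switch_crossing_def ib)
  have slice: "slice E k = slice D k" by (simp add: E slice_def)
  have pos: "positive_crossing E k"
    using False k ib unfolding positive_crossing_def slice by (auto simp: E)
  have sw: "switch_crossing E k = D"
    using k ib by (simp add: switch_crossing_def E list_update_same_conv)
  have sm: "smooth_crossing E k = smooth_crossing D k"
    using k unfolding smooth_crossing_def slice by (simp add: E ib)
  have "mono_az 1 0 * P E - mono_az (-1) 0 * P D = mono_az 0 1 * P (smooth_crossing D k)"
    using homfly_pt_skein[OF P _ pos] assms(4) unfolding sw sm by (simp add: E_def)
  then have "mono_az (-1) 0 * P D - mono_az 1 0 * P E = - (mono_az 0 1 * P (smooth_crossing D k))"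
    by (simp add: algebra_simps)
  also have "\<dots> = Poly_Mapping.single (0, 1) (- 1) * P (smooth_crossing D k)"
    by (simp add: mono_az_def single_uminus)
  finally show ?thesis using that[of "-1"] by (simp add: E_def)
qed

lemma homfly_pt_skein_tree:
  assumes P: "homfly_pt P" and valid: "valid_skein_tree (Resolve D k S T)"
  obtains e :: int where "e \<in> {1, -1}"
    "mono_az e 0 * P D - mono_az (- e) 0 * P (tree_root S) =
     Poly_Mapping.single (0, 1) e * P (tree_root T)"
proof -
  have iso: "isotopic (switch_crossing D k) (tree_root S)"
    "isotopic (smooth_crossing D k) (tree_root T)"
    using valid by auto
  have "link_diagram (switch_crossing D k)" using iso(1) by (simp add: isotopic_def)
  then show ?thesis
    using homfly_pt_resolve[OF P, of D k] valid that
      homfly_pt_invariant[OF P iso(1)] homfly_pt_invariant[OF P iso(2)] by auto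
qed


section \<open>Coefficients and values of Laurent polynomials\<close>

lemma lookup_single_times:
  fixes p :: "'a :: ab_group_add \<Rightarrow>\<^sub>0 'b :: comm_ring_1"
  shows "Poly_Mapping.lookup (Poly_Mapping.single k c * p) l = c * Poly_Mapping.lookup p (l - k)"
proof -
  have "(\<Sum>q. Poly_Mapping.lookup p q when l = k' + q) = Poly_Mapping.lookup p (l - k')" for k'
  proof -
    have "(\<lambda>q. Poly_Mapping.lookup p q when l = k' + q) = (\<lambda>q. Poly_Mapping.lookup p q when q = l - k')"
      by (auto simp: fun_eq_iff when_def algebra_simps)
    then show ?thesis by (simp only: Sum_any_when_equal)
  qed
  then show ?thesis
    by (simp add: times_poly_mapping.rep_eq prod_fun_def lookup_single when_mult)
qed

lemma lookup_conway:
  "Poly_Mapping.lookup (conway p) j =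
     (\<Sum>k | k \<in> Poly_Mapping.keys p \<and> snd k = j. Poly_Mapping.lookup p k)"
  unfolding conway_def
  by (auto simp: lookup_sum case_prod_unfold lookup_single when_def sum.If_cases Int_def intro!: sum.cong)

definition evaluation :: "real \<Rightarrow> real \<Rightarrow> laurent2 \<Rightarrow> real" where
  "evaluation a z p =
     (\<Sum>k\<in>Poly_Mapping.keys p. of_int (Poly_Mapping.lookup p k) * (a powi fst k * z powi snd k))"

lemma evaluation_superset:
  assumes "finite S" "Poly_Mapping.keys p \<subseteq> S"
  shows "evaluation a z p =
     (\<Sum>k\<in>S. of_int (Poly_Mapping.lookup p k) * (a powi fst k * z powi snd k))"
  unfolding evaluation_def
  by (rule sum.mono_neutral_left) (use assms in \<open>auto simp: in_keys_iff\<close>)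

lemma evaluation_diff: "evaluation a z (p - q) = evaluation a z p - evaluation a z q"
proof -
  let ?S = "Poly_Mapping.keys p \<union> Poly_Mapping.keys q"
  have "Poly_Mapping.keys (p - q) \<subseteq> ?S"
    by (auto simp: in_keys_iff lookup_minus)
  then show ?thesis
    by (simp add: evaluation_superset[of ?S] lookup_minus algebra_simps sum_subtractf)
qed

lemma evaluation_single_times:
  assumes "a \<noteq> 0" "z \<noteq> 0"
  shows "evaluation a z (Poly_Mapping.single (i, j) c * p) =
     of_int c * a powi i * z powi j * evaluation a z p"
proof -
  have sub: "Poly_Mapping.keys (Poly_Mapping.single (i, j) c * p) \<subseteq> (+) (i, j) ` Poly_Mapping.keys p"
  proof
    fix k assume "k \<in> Poly_Mapping.keys (Poly_Mapping.single (i, j) c * p)"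
    then have "k - (i, j) \<in> Poly_Mapping.keys p"
      by (simp add: in_keys_iff lookup_single_times)
    then show "k \<in> (+) (i, j) ` Poly_Mapping.keys p"
      by (intro image_eqI[of _ _ "k - (i, j)"]) auto
  qed
  show ?thesis
    unfolding evaluation_superset[OF finite_imageI[OF finite_keys] sub]
    unfolding evaluation_def
    using assms
    by (simp add: sum.reindex lookup_single_times sum_distrib_left power_int_add)
      (simp add: mult_ac)
qed


section \<open>The top power of the second variable along a skein tree\<close>

text \<open>The invariant of skein trees: \<open>n\<close> bounds the \<open>z\<close>-degree, and the coefficient of \<open>z^n\<close>, a
  Laurent polynomial in \<open>a\<close>, is zero or a signed monomial.  The value 0 is allowed for branches
  that are shorter than the tree.\<close>

definition top_z_unit :: "nat \<Rightarrow> laurent2 \<Rightarrow> bool" where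
  "top_z_unit n p \<longleftrightarrow>
     (\<forall>i j. j > int n \<longrightarrow> Poly_Mapping.lookup p (i, j) = 0) \<and>
     (\<exists>k. \<exists>e\<in>{0, 1, -1}. \<forall>i. Poly_Mapping.lookup p (i, int n) = (if i = k then e else 0))"

lemma top_z_unit_mono:
  assumes "top_z_unit m p" "m \<le> n" shows "top_z_unit n p"
proof (cases "m = n")
  case False
  then have "Poly_Mapping.lookup p (i, j) = 0" if "j \<ge> int n" for i j
    using assms that unfolding top_z_unit_def by auto
  then show ?thesis unfolding top_z_unit_def by auto
qed (use assms in simp)

text \<open>Only the smoothed diagram, whose polynomial is multiplied by \<open>z\<close>, contributes to the new top
  power of \<open>z\<close>, so no two units are ever added there.\<close>

lemma top_z_unit_skein:
  assumes p: "top_z_unit n p" and q: "top_z_unit n q" and e: "e \<in> {1, -1}"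
    and eq: "mono_az f 0 * r - mono_az g 0 * p = Poly_Mapping.single (0, 1) e * q"
  shows "top_z_unit (Suc n) r"
proof -
  have r: "Poly_Mapping.lookup r (i, j) =
      Poly_Mapping.lookup p (i + f - g, j) + e * Poly_Mapping.lookup q (i + f, j - 1)" for i j
    using arg_cong[OF eq, of "\<lambda>p. Poly_Mapping.lookup p (i + f, j)"]
    by (simp add: mono_az_def lookup_minus lookup_single_times diff_add_eq)
  have p0: "Poly_Mapping.lookup p (i, j) = 0" if "j > int n" for i j
    using p that by (auto simp: top_z_unit_def)
  have q0: "Poly_Mapping.lookup q (i, j) = 0" if "j > int n" for i j
    using q that by (auto simp: top_z_unit_def)
  obtain k u where u: "u \<in> {0, 1, -1}"
    and top: "\<And>i. Poly_Mapping.lookup q (i, int n) = (if i = k then u else 0)"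
    using q unfolding top_z_unit_def by blast
  have "Poly_Mapping.lookup r (i, j) = 0" if "j > int (Suc n)" for i j
    using that by (simp add: r p0 q0)
  moreover have "Poly_Mapping.lookup r (i, int (Suc n)) = (if i = k - f then e * u else 0)" for i
    by (auto simp: r p0 top)
  moreover have "e * u \<in> {0, 1, -1}" using e u by auto
  ultimately show ?thesis unfolding top_z_unit_def by blast
qed

lemma conway_top_z_unit:
  assumes p: "top_z_unit n p" and z: "z_degree p = int n" and "p \<noteq> 0"
  shows "Poly_Mapping.lookup (conway p) (int n) \<in> {1, -1}"
proof -
  obtain k u where u: "u \<in> {0, 1, -1}"
    and top: "\<And>i. Poly_Mapping.lookup p (i, int n) = (if i = k then u else 0)"
    using p unfolding top_z_unit_def by blast
  have "Poly_Mapping.keys p \<noteq> {}" using assms(3) by simp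
  then have "int n \<in> snd ` Poly_Mapping.keys p"
    using z Max_in[of "snd ` Poly_Mapping.keys p"] by (simp add: z_degree_def)
  then obtain i where "Poly_Mapping.lookup p (i, int n) \<noteq> 0" by (auto simp: in_keys_iff)
  then have u0: "u \<noteq> 0" by (auto simp: top split: if_splits)
  have "{l \<in> Poly_Mapping.keys p. snd l = int n} = {(k, int n)}"
    using u0 by (auto simp: in_keys_iff top split: if_splits)
  then show ?thesis using u u0 by (simp add: lookup_conway top)
qed

text \<open>Each further circle multiplies the polynomial by \<open>(a - 1/a) / z\<close>, which lowers the
  \<open>z\<close>-exponents by one.\<close>

lemma homfly_pt_unlink_z_degree:
  assumes P: "homfly_pt P" and "n > 0" and "j > 1 - int n"
  shows "Poly_Mapping.lookup (P (concat (replicate n unknot))) (i, j) = 0"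
  using assms(2,3)
proof (induction n arbitrary: i j rule: nat_induct_non_zero)
  case 1
  have "P (concat (replicate 1 unknot)) = 1"
    using P by (simp add: homfly_pt_def)
  then show ?case using 1 by (simp add: lookup_one when_def prod_eq_iff)
next
  case (Suc n)
  have "Poly_Mapping.lookup (P (concat (replicate (Suc n) unknot))) (i, j) =
      Poly_Mapping.lookup (P (concat (replicate n unknot))) (i - 1, j + 1) -
      Poly_Mapping.lookup (P (concat (replicate n unknot))) (i + 1, j + 1)"
    using arg_cong[OF homfly_pt_add_circle[OF P Suc.hyps(1)],
        of "\<lambda>p. Poly_Mapping.lookup p (i, j + 1)"]
    by (simp only: mono_az_def lookup_minus lookup_single_times) simp
  then show ?case using Suc.IH[of "j + 1"] Suc.prems by simp
qed

lemma homfly_pt_unlink_top_z_unit: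
  assumes P: "homfly_pt P" and n: "n > 0"
  shows "top_z_unit 0 (P (concat (replicate n unknot)))"
proof (cases "n = 1")
  case True
  then have "P (concat (replicate n unknot)) = 1"
    using P by (simp add: homfly_pt_def)
  then have "Poly_Mapping.lookup (P (concat (replicate n unknot))) (i, j)
      = (if i = 0 \<and> j = 0 then 1 else 0)" for i j
    by (simp add: lookup_one when_def zero_prod_def)
  then show ?thesis unfolding top_z_unit_def by auto
next
  case False
  then have "Poly_Mapping.lookup (P (concat (replicate n unknot))) (i, j) = 0" if "j \<ge> 0" for i j
    using n that by (intro homfly_pt_unlink_z_degree[OF P]) auto
  then show ?thesis unfolding top_z_unit_def by auto
qed

lemma skein_tree_top_z_unit:
  assumes P: "homfly_pt P" and "valid_skein_tree T"
  shows "top_z_unit (tree_depth T) (P (tree_root T))"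
  using assms(2)
proof (induction T)
  case (Leaf D)
  then obtain n where "n > 0" "isotopic (concat (replicate n unknot)) D"
    by (auto simp: unlink_diagram_def)
  then show ?case
    using homfly_pt_unlink_top_z_unit[OF P] homfly_pt_invariant[OF P] by simp metis
next
  case (Resolve D k S T)
  let ?n = "max (tree_depth S) (tree_depth T)"
  obtain e where e: "e \<in> {1, -1}"
    and eq: "mono_az e 0 * P D - mono_az (- e) 0 * P (tree_root S) =
      Poly_Mapping.single (0, 1) e * P (tree_root T)"
    using homfly_pt_skein_tree[OF P Resolve.prems] by blast
  have "top_z_unit ?n (P (tree_root S))" "top_z_unit ?n (P (tree_root T))"
    using Resolve by (auto intro: top_z_unit_mono)
  from top_z_unit_skein[OF this e eq] show ?case by simp
qed

text \<open>At \<open>a = 2\<close>, \<open>z = a - 1/a = 3/2\<close> all polynomials in a skein tree take the value 1.  This shows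
  that none of them is the zero polynomial.  Any nonzero real \<open>a\<close> with \<open>a - 1/a\<close> nonzero would
  serve.\<close>

lemma homfly_pt_unlink_evaluation:
  assumes P: "homfly_pt P" and "n > 0"
  shows "evaluation 2 (3/2) (P (concat (replicate n unknot))) = 1"
  using assms(2)
proof (induction n rule: nat_induct_non_zero)
  case 1
  have "P (concat (replicate 1 unknot)) = 1"
    using P by (simp add: homfly_pt_def)
  then show ?case by (simp add: evaluation_def)
next
  case (Suc n)
  from arg_cong[OF homfly_pt_add_circle[OF P Suc.hyps(1)], of "evaluation 2 (3/2)"] Suc.IH
  show ?case
    by (simp only: mono_az_def evaluation_diff evaluation_single_times) simp
qed

lemma skein_tree_evaluation:
  assumes P: "homfly_pt P" and "valid_skein_tree T"
  shows "evaluation 2 (3/2) (P (tree_root T)) = 1"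
  using assms(2)
proof (induction T)
  case (Leaf D)
  then obtain n where "n > 0" "isotopic (concat (replicate n unknot)) D"
    by (auto simp: unlink_diagram_def)
  then show ?case
    using homfly_pt_unlink_evaluation[OF P] homfly_pt_invariant[OF P] by simp metis
next
  case (Resolve D k S T)
  obtain e where e: "e \<in> {1, -1}"
    and eq: "mono_az e 0 * P D - mono_az (- e) 0 * P (tree_root S) =
      Poly_Mapping.single (0, 1) e * P (tree_root T)"
    using homfly_pt_skein_tree[OF P Resolve.prems] by blast
  have "evaluation 2 (3/2) (P (tree_root S)) = 1" "evaluation 2 (3/2) (P (tree_root T)) = 1"
    using Resolve by auto
  with arg_cong[OF eq, of "evaluation 2 (3/2)"]
  have "2 powi e * evaluation 2 (3/2) (P D) - 2 powi (- e) = of_int e * (3/2)"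
    by (simp only: mono_az_def evaluation_diff evaluation_single_times) simp
  then show ?case using e by auto
qed

text \<open>If there is no skein tree, the depth is infinite, so the bound need only be checked on each
  tree separately.\<close>

lemma skein_tree_depth_ge:
  assumes P: "homfly_pt P"
    and c: "Poly_Mapping.lookup (conway (P K)) (z_degree (P K)) \<notin> {1, -1}"
  shows "enat (nat (z_degree (P K) + 1)) \<le> skein_tree_depth K"
  unfolding skein_tree_depth_def
proof (rule INF_greatest)
  fix T assume "T \<in> {T. valid_skein_tree T \<and> isotopic K (tree_root T)}"
  then have T: "valid_skein_tree T" and eq: "P K = P (tree_root T)"
    using homfly_pt_invariant[OF P] by auto
  have unit: "top_z_unit (tree_depth T) (P K)"
    using skein_tree_top_z_unit[OF P T] by (simp add: eq)
  have nz: "P K \<noteq> 0"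
    using skein_tree_evaluation[OF P T] by (auto simp: eq evaluation_def)
  then have "z_degree (P K) \<in> snd ` Poly_Mapping.keys (P K)"
    unfolding z_degree_def by (intro Max_in) auto
  then obtain i where "Poly_Mapping.lookup (P K) (i, z_degree (P K)) \<noteq> 0"
    by (auto simp: in_keys_iff)
  then have "z_degree (P K) \<le> int (tree_depth T)"
    using unit unfolding top_z_unit_def by (meson not_le)
  moreover have "z_degree (P K) \<noteq> int (tree_depth T)"
    using conway_top_z_unit[OF unit _ nz] c by auto
  ultimately show "enat (nat (z_degree (P K) + 1)) \<le> enat (tree_depth T)" by simp
qed


section \<open>The span of the Alexander polynomial\<close>

text \<open>The exponents are given by a function \<open>g\<close> on the index set so that the lemma serves both for
  the top term at infinity and, with negated exponents, for the bottom term at 0.\<close>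

lemma tendsto_power_sum_top:
  fixes c :: "'a \<Rightarrow> real" and g :: "'a \<Rightarrow> int"
  assumes "finite S" "k \<in> S" "\<And>l. l \<in> S \<Longrightarrow> l \<noteq> k \<Longrightarrow> g l < g k"
  shows "((\<lambda>x::real. (\<Sum>l\<in>S. c l * x powi g l) / x powi g k) \<longlongrightarrow> c k) at_infinity"
proof -
  have "((\<lambda>x::real. \<Sum>l\<in>S. c l * inverse x ^ nat (g k - g l))
      \<longlongrightarrow> (\<Sum>l\<in>S. if l = k then c k else 0)) at_infinity"
  proof (rule tendsto_sum)
    fix l assume l: "l \<in> S"
    show "((\<lambda>x::real. c l * inverse x ^ nat (g k - g l)) \<longlongrightarrow> (if l = k then c k else 0)) at_infinity"
    proof (cases "l = k")
      case False
      have "((\<lambda>x::real. c l * inverse x ^ nat (g k - g l)) \<longlongrightarrow> c l * 0 ^ nat (g k - g l)) at_infinity"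
        by (intro tendsto_intros tendsto_inverse_0)
      then show ?thesis using False assms(3)[OF l False] by (simp add: power_0_left)
    qed simp
  qed
  also have "(\<Sum>l\<in>S. if l = k then c k else 0) = c k" using assms(1,2) by simp
  finally have lim: "((\<lambda>x::real. \<Sum>l\<in>S. c l * inverse x ^ nat (g k - g l)) \<longlongrightarrow> c k) at_infinity" .
  have "\<forall>\<^sub>F x::real in at_infinity. (\<Sum>l\<in>S. c l * inverse x ^ nat (g k - g l))
      = (\<Sum>l\<in>S. c l * x powi g l) / x powi g k"
    unfolding eventually_at_infinity
  proof (intro exI[of _ 1] allI impI)
    fix x :: real assume "1 \<le> norm x"
    then have x: "x \<noteq> 0" by auto
    have "c l * inverse x ^ nat (g k - g l) = c l * x powi g l / x powi g k" if "l \<in> S" for l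
    proof -
      have "g l \<le> g k" using assms(3)[OF that] by (cases "l = k") auto
      then have "inverse x ^ nat (g k - g l) = x powi (- (g k - g l))"
        by (cases "g l = g k") (auto simp: power_int_def)
      also have "\<dots> = x powi g l / x powi g k"
        using x by (simp add: power_int_diff)
      finally show ?thesis by simp
    qed
    then show "(\<Sum>l\<in>S. c l * inverse x ^ nat (g k - g l)) = (\<Sum>l\<in>S. c l * x powi g l) / x powi g k"
      by (simp add: sum_divide_distrib)
  qed
  from tendsto_cong[OF this] lim show ?thesis by simp
qed

lemma leading_coeff_nonzero:
  assumes "p \<noteq> 0" shows "leading_coeff p \<noteq> 0"
proof -
  have "Max (Poly_Mapping.keys p) \<in> Poly_Mapping.keys p" using assms by (intro Max_in) auto
  then show ?thesis unfolding leading_coeff_def in_keys_iff .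
qed

lemma lookup_Min_keys_nonzero:
  assumes "p \<noteq> 0" shows "Poly_Mapping.lookup p (Min (Poly_Mapping.keys p)) \<noteq> 0"
proof -
  have "Min (Poly_Mapping.keys p) \<in> Poly_Mapping.keys p" using assms by (intro Min_in) auto
  then show ?thesis unfolding in_keys_iff .
qed

lemma laurent_eval_at_infinity:
  assumes "p \<noteq> 0"
  shows "((\<lambda>x. laurent_eval p x / x powi Max (Poly_Mapping.keys p))
     \<longlongrightarrow> of_int (leading_coeff p)) at_infinity"
proof -
  have ne: "Poly_Mapping.keys p \<noteq> {}" using assms by simp
  show ?thesis
    unfolding laurent_eval_def leading_coeff_def
    by (rule tendsto_power_sum_top) (use ne in \<open>auto simp: order_less_le\<close>)
qed

lemma laurent_eval_inverse_at_infinity: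
  assumes "p \<noteq> 0"
  defines "m \<equiv> Min (Poly_Mapping.keys p)"
  shows "((\<lambda>x. laurent_eval p (inverse x) / x powi (- m))
     \<longlongrightarrow> of_int (Poly_Mapping.lookup p m)) at_infinity"
proof -
  have ne: "Poly_Mapping.keys p \<noteq> {}" using assms by simp
  have "((\<lambda>x::real. (\<Sum>l\<in>Poly_Mapping.keys p. of_int (Poly_Mapping.lookup p l) * x powi (- l))
      / x powi (- m)) \<longlongrightarrow> of_int (Poly_Mapping.lookup p m)) at_infinity"
  proof (rule tendsto_power_sum_top)
    fix l assume "l \<in> Poly_Mapping.keys p" "l \<noteq> m"
    then show "- l < - m" unfolding m_def by (simp add: order_less_le)
  qed (use ne in \<open>simp_all add: m_def\<close>)
  then show ?thesis by (simp add: laurent_eval_def power_int_minus power_int_inverse)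
qed

lemma growth_order_unique:
  fixes f :: "real \<Rightarrow> real" and i j :: int
  assumes f: "((\<lambda>x. f x / x powi i) \<longlongrightarrow> \<alpha>) at_top" "((\<lambda>x. f x / x powi j) \<longlongrightarrow> \<beta>) at_top"
    and nz: "\<alpha> \<noteq> 0" "\<beta> \<noteq> 0"
  shows "i = j"
proof -
  have False if "i < j" "((\<lambda>x. f x / x powi i) \<longlongrightarrow> \<alpha>) at_top" "((\<lambda>x. f x / x powi j) \<longlongrightarrow> \<beta>) at_top"
    "\<beta> \<noteq> 0" for i j \<alpha> \<beta>
  proof -
    have "((\<lambda>x::real. inverse x ^ nat (j - i)) \<longlongrightarrow> 0 ^ nat (j - i)) at_top"
      by (intro tendsto_power tendsto_inverse_0_at_top filterlim_ident)
    then have "((\<lambda>x. f x / x powi i * inverse x ^ nat (j - i)) \<longlongrightarrow> \<alpha> * 0) at_top"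
      using that by (intro tendsto_mult) (simp_all add: power_0_left)
    moreover have "\<forall>\<^sub>F x in at_top. f x / x powi i * inverse x ^ nat (j - i) = f x / x powi j"
      using eventually_gt_at_top[of 0]
    proof eventually_elim
      case (elim x)
      have "x powi j = x powi i * x ^ nat (j - i)"
        using elim that(1) power_int_add[of x i "j - i"] by (simp add: power_int_def)
      then show ?case by (simp add: field_simps)
    qed
    ultimately have "((\<lambda>x. f x / x powi j) \<longlongrightarrow> 0) at_top" by (simp add: tendsto_cong)
    from tendsto_unique[OF _ this that(3)] that(4) show False by simp
  qed
  from this[of i j] this[of j i] assms show ?thesis by (metis linorder_neqE)
qed

text \<open>Put \<open>t = x\<^sup>2\<close>.  As \<open>x\<close> tends to infinity, \<open>A\<close> grows like its top term in \<open>x\<^sup>2\<close>, while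
  \<open>N (x - 1 / x)\<close> grows like the top term of \<open>N\<close>; this determines the largest exponent of \<open>A\<close>.
  Putting \<open>t = 1 / x\<^sup>2\<close> replaces \<open>x - 1 / x\<close> by its negative, so that the same term of \<open>N\<close>
  determines the smallest exponent of \<open>A\<close>.  The unknown shift \<open>r\<close> cancels in the difference.\<close>

lemma alexander_of_asymptotics:
  assumes AN: "alexander_of N A" and A: "A \<noteq> 0" and N: "N \<noteq> 0"
  shows "Max (Poly_Mapping.keys A) - Min (Poly_Mapping.keys A) = Max (Poly_Mapping.keys N)"
    and "\<bar>leading_coeff A\<bar> = \<bar>leading_coeff N\<bar>"
proof -
  let ?m = "Max (Poly_Mapping.keys N)" and ?M = "Max (Poly_Mapping.keys A)"
    and ?\<mu> = "Min (Poly_Mapping.keys A)"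
  obtain u r where u: "u \<in> {1, -1 :: real}"
    and eq: "\<And>t. t > 0 \<Longrightarrow>
      laurent_eval A t = u * t powi r * laurent_eval N (sqrt t - 1 / sqrt t)"
    using AN unfolding alexander_of_def by blast
  have lead: "leading_coeff A \<noteq> 0" "leading_coeff N \<noteq> 0"
    "Poly_Mapping.lookup A ?\<mu> \<noteq> 0"
    using A N by (auto dest: leading_coeff_nonzero lookup_Min_keys_nonzero)
  have sq: "filterlim (\<lambda>x::real. x\<^sup>2) at_infinity at_top"
    by (intro filterlim_at_top_imp_at_infinity filterlim_pow_at_top filterlim_ident) auto
  have w: "filterlim (\<lambda>x::real. x - inverse x) at_top at_top"
  proof -
    have "((\<lambda>x::real. - inverse x) \<longlongrightarrow> - 0) at_top"
      by (intro tendsto_minus tendsto_inverse_0_at_top filterlim_ident)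
    from filterlim_tendsto_add_at_top[OF this filterlim_ident] show ?thesis by simp
  qed
  have w': "filterlim (\<lambda>x::real. x - inverse x) at_infinity at_top"
    "filterlim (\<lambda>x::real. - (x - inverse x)) at_infinity at_top"
    by (rule filterlim_at_top_imp_at_infinity[OF w],
        rule filterlim_at_bot_imp_at_infinity[OF w[unfolded filterlim_uminus_at_top]])
  have ratio: "((\<lambda>x::real. ((x - inverse x) / x) powi ?m) \<longlongrightarrow> 1) at_top"
  proof -
    have "((\<lambda>x::real. 1 - inverse x * inverse x) \<longlongrightarrow> 1 - 0 * 0) at_top"
      by (intro tendsto_intros tendsto_inverse_0_at_top filterlim_ident)
    moreover have "\<forall>\<^sub>F x::real in at_top. 1 - inverse x * inverse x = (x - inverse x) / x"
      using eventually_gt_at_top[of 0] by eventually_elim (simp add: field_simps)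
    ultimately have "((\<lambda>x::real. (x - inverse x) / x) \<longlongrightarrow> 1) at_top"
      by (simp add: tendsto_cong)
    from tendsto_power_int[OF this, of ?m] show ?thesis by simp
  qed
  have growth: "((\<lambda>x. \<bar>laurent_eval N (s * (x - inverse x))\<bar> / x powi ?m)
      \<longlongrightarrow> \<bar>of_int (leading_coeff N)\<bar>) at_top" if s: "s \<in> {1, -1}" for s
  proof -
    have "filterlim (\<lambda>x::real. s * (x - inverse x)) at_infinity at_top" using w' s by auto
    from tendsto_mult[OF tendsto_rabs[OF filterlim_compose[OF laurent_eval_at_infinity[OF N] this]] ratio]
    have "((\<lambda>x. \<bar>laurent_eval N (s * (x - inverse x)) / (s * (x - inverse x)) powi ?m\<bar>
        * ((x - inverse x) / x) powi ?m) \<longlongrightarrow> \<bar>of_int (leading_coeff N)\<bar>) at_top" by simp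
    moreover have "\<forall>\<^sub>F x in at_top.
        \<bar>laurent_eval N (s * (x - inverse x)) / (s * (x - inverse x)) powi ?m\<bar>
        * ((x - inverse x) / x) powi ?m = \<bar>laurent_eval N (s * (x - inverse x))\<bar> / x powi ?m"
      using eventually_gt_at_top[of 0] eventually_compose_filterlim[OF eventually_gt_at_top[of 0] w]
    proof eventually_elim
      case (elim x)
      define y where "y = x - inverse x"
      have "\<bar>s * y\<bar> = y" using s elim(2) by (auto simp: y_def)
      then have "\<bar>(s * y) powi ?m\<bar> = y powi ?m" by (simp only: power_int_abs)
      then show ?case using elim unfolding y_def[symmetric]
        by (simp add: abs_divide power_int_divide_distrib)
    qed
    ultimately show ?thesis by (simp add: tendsto_cong)
  qed
  have top: "((\<lambda>x. \<bar>laurent_eval A (x\<^sup>2)\<bar> / x powi (2 * ?M))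
      \<longlongrightarrow> \<bar>of_int (leading_coeff A)\<bar>) at_top"
    using tendsto_rabs[OF filterlim_compose[OF laurent_eval_at_infinity[OF A] sq]]
    by (simp add: abs_divide power_int_abs power_int_mult)
  have top': "((\<lambda>x. \<bar>laurent_eval A (x\<^sup>2)\<bar> / x powi (2 * r + ?m))
      \<longlongrightarrow> \<bar>of_int (leading_coeff N)\<bar>) at_top"
  proof -
    have "\<forall>\<^sub>F x in at_top. \<bar>laurent_eval N (1 * (x - inverse x))\<bar> / x powi ?m
        = \<bar>laurent_eval A (x\<^sup>2)\<bar> / x powi (2 * r + ?m)"
      using eventually_gt_at_top[of 0]
    proof eventually_elim
      case (elim x)
      have "\<bar>laurent_eval A (x\<^sup>2)\<bar> = x powi (2 * r) * \<bar>laurent_eval N (x - inverse x)\<bar>"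
        using u elim by (auto simp: eq abs_mult power_int_abs power_int_mult inverse_eq_divide)
      then show ?case using elim by (simp add: power_int_add)
    qed
    from tendsto_cong[OF this] growth[of 1] show ?thesis by simp
  qed
  have bot: "((\<lambda>x. \<bar>laurent_eval A (inverse (x\<^sup>2))\<bar> / x powi (2 * - ?\<mu>))
      \<longlongrightarrow> \<bar>of_int (Poly_Mapping.lookup A ?\<mu>)\<bar>) at_top"
    using tendsto_rabs[OF filterlim_compose[OF laurent_eval_inverse_at_infinity[OF A] sq]]
    unfolding power_int_mult by (simp add: abs_divide power_int_abs)
  have bot': "((\<lambda>x. \<bar>laurent_eval A (inverse (x\<^sup>2))\<bar> / x powi (2 * - r + ?m))
      \<longlongrightarrow> \<bar>of_int (leading_coeff N)\<bar>) at_top"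
  proof -
    have "\<forall>\<^sub>F x in at_top. \<bar>laurent_eval N (-1 * (x - inverse x))\<bar> / x powi ?m
        = \<bar>laurent_eval A (inverse (x\<^sup>2))\<bar> / x powi (2 * - r + ?m)"
      using eventually_gt_at_top[of 0]
    proof eventually_elim
      case (elim x)
      have z: "sqrt (inverse (x\<^sup>2)) - 1 / sqrt (inverse (x\<^sup>2)) = -1 * (x - inverse x)"
        using elim by (simp add: real_sqrt_inverse divide_inverse)
      have p: "(inverse (x\<^sup>2)) powi r = x powi (2 * - r)"
        unfolding power_int_mult by (simp add: power_int_minus power_int_inverse)
      have "\<bar>laurent_eval A (inverse (x\<^sup>2))\<bar> =
          x powi (2 * - r) * \<bar>laurent_eval N (-1 * (x - inverse x))\<bar>"
        using u elim eq[of "inverse (x\<^sup>2)"] unfolding z p by (auto simp: abs_mult power_int_abs)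
      moreover have "x powi (2 * - r + ?m) = x powi (2 * - r) * x powi ?m"
        by (rule power_int_add) (use elim in simp)
      ultimately show ?case using elim by simp
    qed
    from tendsto_cong[OF this] growth[of "-1"] show ?thesis by simp
  qed
  have M: "2 * ?M = 2 * r + ?m"
    by (rule growth_order_unique[OF top top']) (use lead in auto)
  have "2 * - ?\<mu> = 2 * - r + ?m"
    by (rule growth_order_unique[OF bot bot']) (use lead in auto)
  with M show "?M - ?\<mu> = ?m" by linarith
  have "\<bar>of_int (leading_coeff A) :: real\<bar> = \<bar>of_int (leading_coeff N)\<bar>"
    using tendsto_unique[OF _ top top'[folded M]] by simp
  then show "\<bar>leading_coeff A\<bar> = \<bar>leading_coeff N\<bar>" by linarith
qed

text \<open>A Laurent polynomial that vanishes at all positive reals is zero, and \<open>s - 1 / s\<close> takes every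
  positive value at some positive \<open>s\<close>.\<close>

lemma alexander_of_eq_0_iff:
  assumes AN: "alexander_of N A"
  shows "A = 0 \<longleftrightarrow> N = 0"
proof -
  obtain u r where u: "u \<in> {1, -1 :: real}"
    and eq: "\<And>t. t > 0 \<Longrightarrow>
      laurent_eval A t = u * t powi r * laurent_eval N (sqrt t - 1 / sqrt t)"
    using AN unfolding alexander_of_def by blast
  have vanish: "p = 0" if "\<And>x. x > 0 \<Longrightarrow> laurent_eval p x = 0" for p
  proof (rule ccontr)
    assume p: "p \<noteq> 0"
    have lim: "((\<lambda>x. laurent_eval p x / x powi Max (Poly_Mapping.keys p))
        \<longlongrightarrow> of_int (leading_coeff p)) at_top"
      using laurent_eval_at_infinity[OF p] at_top_le_at_infinity by (rule tendsto_mono[rotated])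
    have "\<forall>\<^sub>F x in at_top. laurent_eval p x / x powi Max (Poly_Mapping.keys p) = 0"
      using eventually_gt_at_top[of 0] by eventually_elim (simp add: that)
    from lim[unfolded tendsto_cong[OF this]]
    have "leading_coeff p = 0" by (simp add: tendsto_const_iff)
    with leading_coeff_nonzero[OF p] show False by simp
  qed
  show ?thesis
  proof
    assume "N = 0"
    then show "A = 0" by (intro vanish) (simp add: eq laurent_eval_def[of 0])
  next
    assume A: "A = 0"
    show "N = 0"
    proof (rule vanish)
      fix x :: real assume x: "x > 0"
      (* the positive solution of s - 1 / s = x *)
      define s where "s = (x + sqrt (x\<^sup>2 + 4)) / 2"
      have s: "s > 0" using x by (simp add: s_def add_pos_nonneg)
      have "(2 * s - x)\<^sup>2 = x\<^sup>2 + 4"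
        by (simp add: s_def add_divide_distrib)
      then have "s * s - 1 = x * s"
        by (simp add: power2_eq_square algebra_simps)
      then have root: "s - 1 / s = x" using s by (simp add: field_simps)
      have "laurent_eval A (s\<^sup>2) = u * (s\<^sup>2) powi r * laurent_eval N x"
        using eq[of "s\<^sup>2"] s by (simp add: root)
      moreover have "laurent_eval A (s\<^sup>2) = 0" by (simp add: A laurent_eval_def)
      ultimately show "laurent_eval N x = 0" using s u by auto
    qed
  qed
qed

lemma exponent_span_0: "exponent_span 0 = - \<infinity>"
  by (simp add: exponent_span_def bot_ereal_def top_ereal_def)

lemma exponent_span_nonzero:
  assumes "p \<noteq> 0"
  shows "exponent_span p = ereal (of_int (Max (Poly_Mapping.keys p) - Min (Poly_Mapping.keys p)))"
proof -
  have ne: "Poly_Mapping.keys p \<noteq> {}" using assms by simp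
  have "(SUP k\<in>Poly_Mapping.keys p. ereal (of_int k)) = ereal (of_int (Max (Poly_Mapping.keys p)))"
    by (rule SUP_eqI) (use ne in auto)
  moreover have "(INF k\<in>Poly_Mapping.keys p. ereal (of_int k)) = ereal (of_int (Min (Poly_Mapping.keys p)))"
    by (rule INF_eqI) (use ne in auto)
  ultimately show ?thesis by (simp add: exponent_span_def)
qed

lemma conway_degree_le:
  assumes "conway p \<noteq> 0"
  shows "Max (Poly_Mapping.keys (conway p)) \<le> z_degree p"
proof -
  let ?m = "Max (Poly_Mapping.keys (conway p))"
  have "Poly_Mapping.lookup (conway p) ?m \<noteq> 0"
    using leading_coeff_nonzero[OF assms] by (simp add: leading_coeff_def)
  then have "{k \<in> Poly_Mapping.keys p. snd k = ?m} \<noteq> {}"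
    unfolding lookup_conway by (metis sum.empty)
  then obtain k where "k \<in> Poly_Mapping.keys p" "snd k = ?m" by auto
  then have "?m \<in> snd ` Poly_Mapping.keys p" by force
  then show ?thesis unfolding z_degree_def by (intro Max_ge) auto
qed

lemma alexander_span_cases:
  assumes "alexander_of (conway p) \<Delta>"
  shows "(exponent_span \<Delta> < ereal (of_int (z_degree p)) \<and>
      Poly_Mapping.lookup (conway p) (z_degree p) = 0) \<or>
    (exponent_span \<Delta> = ereal (of_int (z_degree p)) \<and>
      \<bar>Poly_Mapping.lookup (conway p) (z_degree p)\<bar> = \<bar>leading_coeff \<Delta>\<bar>)"
proof (cases "conway p = 0")
  case True
  then show ?thesis
    using alexander_of_eq_0_iff[OF assms] by (simp add: exponent_span_0)
next
  case False
  let ?m = "Max (Poly_Mapping.keys (conway p))"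
  have \<Delta>: "\<Delta> \<noteq> 0" using False alexander_of_eq_0_iff[OF assms] by simp
  have span: "exponent_span \<Delta> = ereal (of_int ?m)"
    using exponent_span_nonzero[OF \<Delta>] alexander_of_asymptotics(1)[OF assms \<Delta> False] by simp
  have "Poly_Mapping.lookup (conway p) (z_degree p) = 0" if "?m < z_degree p"
    using that by (metis Max_ge finite_keys in_keys_iff not_le)
  moreover have "\<bar>Poly_Mapping.lookup (conway p) ?m\<bar> = \<bar>leading_coeff \<Delta>\<bar>"
    using alexander_of_asymptotics(2)[OF assms \<Delta> False] by (simp add: leading_coeff_def)
  ultimately show ?thesis
    using conway_degree_le[OF False] span by (cases "?m = z_degree p") auto
qed

theorem corollary3p4:
  fixes P :: "diagram \<Rightarrow> laurent2" and K :: diagram and d :: int and c :: "int \<Rightarrow> int"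
  assumes homfly: "homfly_pt P"
    and knot: "knot_diagram K"
    and d: "d = z_degree (P K)"
    and c: "\<And>j. c j = Poly_Mapping.lookup (conway (P K)) j"
  shows "(c d \<notin> {1, -1} \<longrightarrow> skein_tree_depth K \<ge> enat (nat (d + 1))) \<and>
    (\<forall>\<Delta>. alexander_of (conway (P K)) \<Delta> \<longrightarrow>
       (exponent_span \<Delta> < ereal (of_int d) \<and> c d = 0 \<and>
          skein_tree_depth K \<ge> enat (nat (d + 1))) \<or>
       (exponent_span \<Delta> = ereal (of_int d) \<and> \<bar>c d\<bar> = \<bar>leading_coeff \<Delta>\<bar> \<and>
          (leading_coeff \<Delta> \<notin> {1, -1} \<longrightarrow> skein_tree_depth K \<ge> enat (nat (d + 1)))))"
proof -
  have cd: "c d = Poly_Mapping.lookup (conway (P K)) (z_degree (P K))" by (simp add: c d)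
  have bound: "enat (nat (d + 1)) \<le> skein_tree_depth K" if "c d \<notin> {1, -1}"
  proof -
    have "Poly_Mapping.lookup (conway (P K)) (z_degree (P K)) \<notin> {1, -1}"
      using that unfolding cd .
    from skein_tree_depth_ge[OF homfly this] show ?thesis unfolding d .
  qed
  show ?thesis
  proof (intro conjI impI allI)
    fix \<Delta> assume "alexander_of (conway (P K)) \<Delta>"
    from alexander_span_cases[OF this]
    consider "exponent_span \<Delta> < ereal (of_int d)" "c d = 0"
      | "exponent_span \<Delta> = ereal (of_int d)" "\<bar>c d\<bar> = \<bar>leading_coeff \<Delta>\<bar>"
      unfolding c d by blast
    then show "(exponent_span \<Delta> < ereal (of_int d) \<and> c d = 0 \<and>
          skein_tree_depth K \<ge> enat (nat (d + 1))) \<or>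
       (exponent_span \<Delta> = ereal (of_int d) \<and> \<bar>c d\<bar> = \<bar>leading_coeff \<Delta>\<bar> \<and>
          (leading_coeff \<Delta> \<notin> {1, -1} \<longrightarrow> skein_tree_depth K \<ge> enat (nat (d + 1))))"
    proof cases
      case 1
      then show ?thesis using bound by simp
    next
      case 2
      then have "c d \<notin> {1, -1}" if "leading_coeff \<Delta> \<notin> {1, -1}"
        using that by (auto simp: abs_if split: if_splits)
      then show ?thesis using bound 2 by blast
    qed
  qed (fact bound)
qed

end
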